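(* Let $R$ be an integral domain with unit, $p,q\in R$, $U=(U_n)$ with $U_0=0$, $U_1=1$, $U_n=pU_{n-1}-qU_{n-2}$, and $x_n=U_n/U_{n-1}$ for $n\ge2$. Then for all $n\ge2$ (whenever the quotients are defined), $$x_{2n-1}=\frac{x_n^2-q}{2x_n-p},$$ $$x_{3n-2}=x_{n}+\frac{(x_{n}^2-px_{n}+q)(p-2x_{n})}{3x_{n}^2-3px_{n}+p^2-q}.$$ The right-hand sides are respectively one step of the Newton method and one step of the Halley method for $f(t)=t^2-pt+q$ applied to $x_n$; hence these recurrences generate subsequences of $(x_n)$ (e.g. $x_2,x_3,x_5,\dots,x_{2^k+1},\dots$ and $x_2,x_4,x_{10},\dots,x_{3^k+1},\dots$) consisting of the Newton, respectively Halley, approximations of the root of larger modulus of $t^2-pt+q$.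
   Context: Newton's method for $f(t)=0$: $y_{k}=y_{k-1}-f(y_{k-1})/f'(y_{k-1})$, which for $f(t)=t^2-pt+q$ is $y_k=\frac{y_{k-1}^2-q}{2y_{k-1}-p}$. Halley's method: $y_k=y_{k-1}-\frac{2f(y_{k-1})f'(y_{k-1})}{2f'(y_{k-1})^2-f(y_{k-1})f''(y_{k-1})}$, which for $f(t)=t^2-pt+q$ is $y_k=y_{k-1}+\frac{(y_{k-1}^2-py_{k-1}+q)(p-2y_{k-1})}{3y_{k-1}^2-3py_{k-1}+p^2-q}$. *)

theory Defs
  imports Complex_Main "HOL-Computational_Algebra.Computational_Algebra"
begin

definition newton_step :: "'k::field poly \<Rightarrow> 'k \<Rightarrow> 'k" where
  "newton_step f y = y - poly f y / poly (pderiv f) y"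

definition halley_denom :: "'k::field poly \<Rightarrow> 'k \<Rightarrow> 'k" where
  "halley_denom f y = 2 * (poly (pderiv f) y)\<^sup>2 - poly f y * poly (pderiv (pderiv f)) y"

text \<open>
  For quadratic \<open>f\<close>, the denominator vanishes identically in characteristic 2, where
  Halley's method in this form is undefined (and \<open>halley_step f y\<close> is the junk value \<open>y\<close>).
\<close>
definition halley_step :: "'k::field poly \<Rightarrow> 'k \<Rightarrow> 'k" where
  "halley_step f y = y - 2 * poly f y * poly (pderiv f) y / halley_denom f y"

definition field_embedding :: "('k::field \<Rightarrow> 'l::field) \<Rightarrow> bool" where
  "field_embedding \<sigma> \<longleftrightarrow> \<sigma> 1 = 1 \<and> (\<forall>a b. \<sigma> (a + b) = \<sigma> a + \<sigma> b) \<and> (\<forall>a b. \<sigma> (a * b) = \<sigma> a * \<sigma> b)"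

end

theory Submission
  imports Defs
begin

text \<open>
  The addition law \<open>U (m + k) = U m U (k + 1) + U (m + 1) U k - p U m U k\<close> writes
  \<open>U\<close> at \<open>2m\<close>, \<open>2m + 1\<close>, \<open>3m\<close>, \<open>3m + 1\<close> as binary forms in \<open>U (m + 1)\<close> and \<open>U m\<close>;
  dehomogenised at \<open>x = U (m + 1) / U m\<close>, they are the numerators and denominators of the Newton and
  Halley maps. Thus the two maps send the ratio at index \<open>m\<close> to the ratios at \<open>2m\<close> and \<open>3m\<close>, and
  their derivative and denominator vanish at the ratio only if \<open>U (2m)\<close> resp. \<open>U (3m)\<close> does
  (up to characteristic 2). If the roots satisfy \<open>\<bar>\<beta>\<bar> < \<bar>\<alpha>\<bar>\<close>, then
  \<open>U m = (\<alpha>^m - \<beta>^m) / (\<alpha> - \<beta>)\<close> never vanishes for \<open>m \<ge> 1\<close> and the ratios tend to \<open>\<alpha>\<close>.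
\<close>

section \<open>Lucas sequences over a field: addition, doubling and tripling of the index\<close>

text \<open>Two instances occur: the image of \<open>U\<close> in the fraction field, and the
  further image of that sequence in the complex numbers under an embedding.\<close>

locale lucas_sequence =
  fixes u :: "nat \<Rightarrow> 'k::field" and P Q :: 'k
  assumes u_0 [simp]: "u 0 = 0"
    and u_Suc_0 [simp]: "u (Suc 0) = 1"
    and u_rec: "u (Suc (Suc n)) = P * u (Suc n) - Q * u n"
begin

text \<open>Read as \<open>Suc m + k\<close>, the index \<open>m + Suc k\<close> falls under the
  induction hypothesis at \<open>Suc m\<close>, so \<open>m\<close> stays arbitrary. The recurrence
  then removes the terms at \<open>Suc (Suc m)\<close> and \<open>Suc (Suc k)\<close>.\<close>

lemma u_add: "u (m + k) = u m * u (Suc k) + u (Suc m) * u k - P * u m * u k"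
proof (induction k arbitrary: m)
  case (Suc k)
  have "u (m + Suc k) = u (Suc m + k)"
    by simp
  then show ?case
    unfolding Suc.IH u_rec by algebra
qed simp

lemma u_double: "u (2 * m) = u m * (2 * u (Suc m) - P * u m)"
  unfolding mult_2[of m] u_add by algebra

text \<open>The addition law at \<open>Suc m\<close> and \<open>m\<close> produces
  \<open>u (Suc (Suc m))\<close>; replacing it by the recurrence makes the mixed terms
  cancel.\<close>

lemma u_Suc_double: "u (Suc (2 * m)) = (u (Suc m))\<^sup>2 - Q * (u m)\<^sup>2"
proof -
  have "Suc (2 * m) = Suc m + m"
    by simp
  then have "u (Suc (2 * m)) = u (Suc m) * u (Suc m) + u (Suc (Suc m)) * u m - P * u (Suc m) * u m"
    using u_add[of "Suc m" m] by (simp only:)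
  then show ?thesis
    unfolding u_rec by algebra
qed

lemma u_triple:
  "u (3 * m) = u m * (3 * (u (Suc m))\<^sup>2 - 3 * P * u (Suc m) * u m + (P\<^sup>2 - Q) * (u m)\<^sup>2)"
proof -
  have "3 * m = m + 2 * m"
    by simp
  then have "u (3 * m) = u m * u (Suc (2 * m)) + u (Suc m) * u (2 * m) - P * u m * u (2 * m)"
    using u_add[of m "2 * m"] by (simp only:)
  then show ?thesis
    unfolding u_double u_Suc_double by algebra
qed

lemma u_Suc_triple:
  "u (Suc (3 * m)) = u (Suc m) ^ 3 - 3 * Q * u (Suc m) * (u m)\<^sup>2 + P * Q * u m ^ 3"
proof -
  have "Suc (3 * m) = Suc m + 2 * m"
    by simp
  then have "u (Suc (3 * m)) =
      u (Suc m) * u (Suc (2 * m)) + u (Suc (Suc m)) * u (2 * m) - P * u (Suc m) * u (2 * m)"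
    using u_add[of "Suc m" "2 * m"] by (simp only:)
  then show ?thesis
    unfolding u_double u_Suc_double u_rec by algebra
qed

section \<open>Ratios of consecutive terms under doubling and tripling of the index\<close>

text \<open>The index is shifted: \<open>x n\<close> of the theorem is \<open>ratio (n - 1)\<close>.
  This turns the index maps from \<open>n\<close> to \<open>2*n - 1\<close> and
  \<open>3*n - 2\<close> into plain multiplication by 2 and 3.\<close>

definition ratio :: "nat \<Rightarrow> 'k" where
  "ratio m = u (Suc m) / u m"

lemma u_Suc_ratio: "u m \<noteq> 0 \<Longrightarrow> u (Suc m) = ratio m * u m"
  by (simp add: ratio_def)

text \<open>The second factor is the derivative of t^2 - P t + Q at \<open>ratio m\<close>, so a
  nonzero \<open>u (2 * m)\<close> keeps the Newton step nondegenerate.\<close>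

lemma u_double_ratio:
  assumes "u m \<noteq> 0"
  shows "u (2 * m) = (u m)\<^sup>2 * (2 * ratio m - P)"
  unfolding u_double u_Suc_ratio[OF assms] by (simp add: algebra_simps power2_eq_square)

text \<open>Up to a factor 2 the second factor is the Halley denominator at \<open>ratio m\<close>;
  it is nonzero as soon as \<open>u (3 * m)\<close> is.\<close>

lemma u_triple_ratio:
  assumes "u m \<noteq> 0"
  shows "u (3 * m) = u m ^ 3 * (3 * (ratio m)\<^sup>2 - 3 * P * ratio m + P\<^sup>2 - Q)"
  unfolding u_triple u_Suc_ratio[OF assms] by algebra

text \<open>Numerator and denominator of \<open>ratio (2 * m)\<close> share the factor
  \<open>(u m)\<^sup>2\<close>, which cancels. Where \<open>2 * ratio m - P\<close> vanishes, so
  does \<open>u (2 * m)\<close>, and both sides are 0 by the convention for division by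
  zero.\<close>

lemma ratio_double:
  assumes "u m \<noteq> 0"
  shows "ratio (2 * m) = ((ratio m)\<^sup>2 - Q) / (2 * ratio m - P)"
proof -
  have "u (Suc (2 * m)) = (u m)\<^sup>2 * ((ratio m)\<^sup>2 - Q)"
    unfolding u_Suc_double u_Suc_ratio[OF assms]
    by (simp add: algebra_simps power2_eq_square)
  then show ?thesis
    using assms by (simp add: ratio_def[of "2 * m"] u_double_ratio)
qed

text \<open>Here a vanishing denominator would make the right side \<open>ratio m\<close> but the
  left side 0, because the correction is added to \<open>ratio m\<close> instead of being merged
  into one fraction.\<close>

lemma ratio_triple:
  assumes "u m \<noteq> 0" and "3 * (ratio m)\<^sup>2 - 3 * P * ratio m + P\<^sup>2 - Q \<noteq> 0"
  shows "ratio (3 * m) = ratio m + ((ratio m)\<^sup>2 - P * ratio m + Q) * (P - 2 * ratio m)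
           / (3 * (ratio m)\<^sup>2 - 3 * P * ratio m + P\<^sup>2 - Q)" (is "_ = _ + ?N / ?D")
proof -
  have "u (Suc (3 * m)) = u m ^ 3 * (ratio m ^ 3 - 3 * Q * ratio m + P * Q)"
    unfolding u_Suc_triple u_Suc_ratio[OF assms(1)] by algebra
  \<comment> \<open>The cubic numerator is split so that division by \<open>?D\<close> leaves
    \<open>ratio m\<close> plus the Halley correction.\<close>
  also have "ratio m ^ 3 - 3 * Q * ratio m + P * Q = ratio m * ?D + ?N"
    by algebra
  finally have "ratio (3 * m) = (ratio m * ?D + ?N) / ?D"
    using assms(1)
    by (simp only: ratio_def[of "3 * m"] u_triple_ratio mult_divide_mult_cancel_left power_not_zero simp_thms)
  then show ?thesis
    using assms(2) by (simp add: add_divide_distrib)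
qed

text \<open>Each step doubles the index. The orbit \<open>y\<close> is an arbitrary sequence, so
  that both explicitly given recurrences and iterates of \<open>newton_step\<close> are
  covered.\<close>

lemma newton_iterate_eq_ratio:
  assumes "y 0 = ratio m"
    and "\<And>j. j < k \<Longrightarrow> y (Suc j) = ((y j)\<^sup>2 - Q) / (2 * y j - P)"
    and "\<And>j. j < k \<Longrightarrow> u (2 ^ j * m) \<noteq> 0"
  shows "y k = ratio (2 ^ k * m)"
  using assms
proof (induction k)
  case (Suc k)
  then show ?case
    using ratio_double[of "2 ^ k * m"] by (simp add: mult.assoc)
qed simp

lemma halley_iterate_eq_ratio:
  assumes "y 0 = ratio m"
    and "\<And>j. j < k \<Longrightarrow> 3 * (y j)\<^sup>2 - 3 * P * y j + P\<^sup>2 - Q \<noteq> 0"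
    and "\<And>j. j < k \<Longrightarrow> y (Suc j) = y j + ((y j)\<^sup>2 - P * y j + Q) * (P - 2 * y j)
           / (3 * (y j)\<^sup>2 - 3 * P * y j + P\<^sup>2 - Q)"
    and "\<And>j. j < k \<Longrightarrow> u (3 ^ j * m) \<noteq> 0"
  shows "y k = ratio (3 ^ k * m)"
  using assms
proof (induction k)
  case (Suc k)
  then have "y k = ratio (3 ^ k * m)"
    by simp
  with Suc.prems(2-4)[of k] show ?case
    using ratio_triple[of "3 ^ k * m"] by (simp add: mult.assoc)
qed simp

end

section \<open>Newton and Halley steps for a monic quadratic\<close>

lemma poly_pderiv_quadratic: "poly (pderiv [:c, b, 1:]) y = 2 * y + (b :: 'k::field)"
  by (simp add: pderiv_pCons)

text \<open>The two terms are put over the common denominator \<open>2 * y - P\<close>. At a zero of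
  it the default values would differ: \<open>newton_step\<close> gives \<open>y\<close>, the
  fraction gives 0.\<close>

lemma newton_step_quadratic:
  fixes P Q y :: "'k::field"
  assumes "2 * y - P \<noteq> 0"
  shows "newton_step [:Q, - P, 1:] y = (y\<^sup>2 - Q) / (2 * y - P)"
  using assms
  by (simp add: newton_step_def poly_pderiv_quadratic field_simps power2_eq_square)

lemma halley_denom_quadratic:
  fixes P Q y :: "'k::field"
  shows "halley_denom [:Q, - P, 1:] y = 2 * (3 * y\<^sup>2 - 3 * P * y + P\<^sup>2 - Q)"
  by (simp add: halley_denom_def pderiv_pCons algebra_simps power2_eq_square)

lemma halley_step_quadratic:
  fixes P Q y :: "'k::field"
  assumes "halley_denom [:Q, - P, 1:] y \<noteq> 0"
  shows "halley_step [:Q, - P, 1:] y =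
    y + (y\<^sup>2 - P * y + Q) * (P - 2 * y) / (3 * y\<^sup>2 - 3 * P * y + P\<^sup>2 - Q)" (is "_ = y + ?N / ?D")
proof -
  \<comment> \<open>The Halley denominator is a multiple of 2, so its being nonzero excludes
    characteristic 2; hence the common factor 2 of numerator and denominator can be cancelled
    below.\<close>
  from assms have "(2::'k) \<noteq> 0"
    unfolding halley_denom_quadratic mult_eq_0_iff by blast
  have "2 * poly [:Q, - P, 1:] y * poly (pderiv [:Q, - P, 1:]) y = 2 * - ?N"
    by (simp add: poly_pderiv_quadratic algebra_simps power2_eq_square)
  then have "halley_step [:Q, - P, 1:] y = y - (2 * - ?N) / (2 * ?D)"
    by (simp only: halley_step_def halley_denom_quadratic)
  also have "(2 * - ?N) / (2 * ?D) = - ?N / ?D"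
    using \<open>(2::'k) \<noteq> 0\<close> by (rule mult_divide_mult_cancel_left)
  finally show ?thesis
    by simp
qed

section \<open>Iterates of the two methods started at a ratio\<close>

context lucas_sequence
begin

lemma newton_step_iterate:
  assumes "\<And>j. j < k \<Longrightarrow> poly (pderiv [:Q, - P, 1:]) ((newton_step [:Q, - P, 1:] ^^ j) (ratio m)) \<noteq> 0"
    and "\<And>j. j < k \<Longrightarrow> u (2 ^ j * m) \<noteq> 0"
  shows "(newton_step [:Q, - P, 1:] ^^ k) (ratio m) = ratio (2 ^ k * m)"
  using assms
  by (intro newton_iterate_eq_ratio[where y = "\<lambda>j. (newton_step [:Q, - P, 1:] ^^ j) (ratio m)"])
    (simp_all add: poly_pderiv_quadratic newton_step_quadratic)

lemma halley_step_iterate: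
  assumes "\<And>j. j < k \<Longrightarrow> halley_denom [:Q, - P, 1:] ((halley_step [:Q, - P, 1:] ^^ j) (ratio m)) \<noteq> 0"
    and "\<And>j. j < k \<Longrightarrow> u (3 ^ j * m) \<noteq> 0"
  shows "(halley_step [:Q, - P, 1:] ^^ k) (ratio m) = ratio (3 ^ k * m)"
proof (rule halley_iterate_eq_ratio[where y = "\<lambda>j. (halley_step [:Q, - P, 1:] ^^ j) (ratio m)"])
  fix j assume "j < k"
  from assms(1)[OF this] show
    "3 * ((halley_step [:Q, - P, 1:] ^^ j) (ratio m))\<^sup>2
       - 3 * P * (halley_step [:Q, - P, 1:] ^^ j) (ratio m) + P\<^sup>2 - Q \<noteq> 0"
    by (metis halley_denom_quadratic mult_zero_right)
qed (use assms in \<open>simp_all add: halley_step_quadratic\<close>)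

text \<open>Identifying the \<open>k\<close>-th iterate with \<open>ratio (2 ^ k * m)\<close>
  requires nonzero derivatives at all earlier iterates, whence the strong induction. The derivative
  at the \<open>k\<close>-th iterate is then a factor of \<open>u (2 * (2 ^ k * m))\<close>, which
  is nonzero.\<close>

lemma newton_iterate_nondegenerate:
  assumes "\<And>i. i \<ge> 1 \<Longrightarrow> u i \<noteq> 0" and "m \<ge> 1"
  shows "poly (pderiv [:Q, - P, 1:]) ((newton_step [:Q, - P, 1:] ^^ k) (ratio m)) \<noteq> 0"
proof (induction k rule: less_induct)
  case (less k)
  have "(newton_step [:Q, - P, 1:] ^^ k) (ratio m) = ratio (2 ^ k * m)"
    using less assms by (intro newton_step_iterate) auto
  moreover have "u (2 ^ k * m) \<noteq> 0" "u (2 * (2 ^ k * m)) \<noteq> 0"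
    using assms by auto
  ultimately show ?case
    using u_double_ratio[of "2 ^ k * m"] by (auto simp: poly_pderiv_quadratic)
qed

text \<open>The same strong induction with \<open>u (3 * (3 ^ k * m))\<close>; the assumption on 2
  takes care of the extra factor 2 in \<open>halley_denom\<close>.\<close>

lemma halley_iterate_nondegenerate:
  assumes "\<And>i. i \<ge> 1 \<Longrightarrow> u i \<noteq> 0" and "m \<ge> 1" and "(2::'k) \<noteq> 0"
  shows "halley_denom [:Q, - P, 1:] ((halley_step [:Q, - P, 1:] ^^ k) (ratio m)) \<noteq> 0"
proof (induction k rule: less_induct)
  case (less k)
  have "(halley_step [:Q, - P, 1:] ^^ k) (ratio m) = ratio (3 ^ k * m)"
    using less assms by (intro halley_step_iterate) auto
  moreover have "u (3 ^ k * m) \<noteq> 0" "u (3 * (3 ^ k * m)) \<noteq> 0"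
    using assms by auto
  ultimately show ?case
    using u_triple_ratio[of "3 ^ k * m"] assms(3)
    unfolding halley_denom_quadratic mult_eq_0_iff by auto
qed

section \<open>Binet's formula and the complex case with roots of different modulus\<close>

text \<open>Powers of \<alpha> and of \<beta> satisfy the recurrence because both are roots of t^2 -
  P t + Q. Multiplying by \<open>\<alpha> - \<beta>\<close> avoids a division.\<close>

lemma binet:
  assumes "P = \<alpha> + \<beta>" and "Q = \<alpha> * \<beta>"
  shows "(\<alpha> - \<beta>) * u n = \<alpha> ^ n - \<beta> ^ n"
proof (induction n rule: induct_nat_012)
  case (ge2 n)
  have "(\<alpha> - \<beta>) * u (Suc (Suc n)) = P * ((\<alpha> - \<beta>) * u (Suc n)) - Q * ((\<alpha> - \<beta>) * u n)"
    by (simp add: u_rec algebra_simps)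
  then show ?case
    unfolding ge2 assms by (simp add: algebra_simps)
qed simp_all

end

text \<open>By Binet's formula a zero at \<open>m\<close> would force \<alpha> and \<beta> to have
  equal \<open>m\<close>-th powers, which their moduli forbid for positive \<open>m\<close>.\<close>

lemma lucas_complex_nonzero:
  assumes "lucas_sequence u (\<alpha> + \<beta>) (\<alpha> * \<beta>)" and "cmod \<beta> < cmod \<alpha>" and "m \<ge> 1"
  shows "u m \<noteq> 0"
proof
  assume "u m = 0"
  then have "cmod \<alpha> ^ m = cmod \<beta> ^ m"
    using lucas_sequence.binet[OF assms(1) refl refl, of m] by (simp flip: norm_power)
  moreover have "cmod \<beta> ^ m < cmod \<alpha> ^ m"
    using assms by (intro power_strict_mono) auto
  ultimately show False
    by simp
qed

text \<open>Dividing numerator and denominator of Binet's quotient by \<open>\<alpha> ^ m\<close>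
  leaves only powers of \<open>\<beta> / \<alpha>\<close>, which tend to 0.\<close>

lemma lucas_complex_ratio_tendsto:
  assumes "lucas_sequence u (\<alpha> + \<beta>) (\<alpha> * \<beta>)" and "cmod \<beta> < cmod \<alpha>"
  shows "(\<lambda>m. u (Suc m) / u m) \<longlonglongrightarrow> \<alpha>"
proof -
  define r where "r = \<beta> / \<alpha>"
  have [simp]: "\<alpha> \<noteq> 0" "\<alpha> \<noteq> \<beta>"
    using assms(2) by auto
  have "cmod r < 1"
    using assms(2) by (simp add: r_def norm_divide)
  then have "(\<lambda>m. (\<alpha> - \<beta> * r ^ m) / (1 - r ^ m)) \<longlonglongrightarrow> (\<alpha> - \<beta> * 0) / (1 - 0)"
    by (intro tendsto_intros) auto
  \<comment> \<open>This includes \<open>m = 0\<close>, where both denominators vanish and both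
    quotients are 0 by convention.\<close>
  moreover have "u (Suc m) / u m = (\<alpha> - \<beta> * r ^ m) / (1 - r ^ m)" for m
  proof -
    have "u (Suc m) / u m = ((\<alpha> - \<beta>) * u (Suc m)) / ((\<alpha> - \<beta>) * u m)"
      by simp
    also have "\<dots> = (\<alpha> ^ Suc m - \<beta> ^ Suc m) / (\<alpha> ^ m - \<beta> ^ m)"
      by (simp only: lucas_sequence.binet[OF assms(1) refl refl])
    also have "\<alpha> ^ Suc m - \<beta> ^ Suc m = \<alpha> ^ m * (\<alpha> - \<beta> * r ^ m)"
      by (simp add: r_def power_divide field_simps)
    also have "\<alpha> ^ m - \<beta> ^ m = \<alpha> ^ m * (1 - r ^ m)"
      by (simp add: r_def power_divide field_simps)
    finally show ?thesis
      by simp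
  qed
  ultimately show ?thesis
    by simp
qed

section \<open>Field embeddings and transport of Lucas sequences\<close>

lemma field_embedding_0:
  assumes "field_embedding \<sigma>" shows "\<sigma> 0 = 0"
proof -
  have "\<sigma> (0 + 0) = \<sigma> 0 + \<sigma> 0"
    using assms unfolding field_embedding_def by blast
  then show ?thesis
    by (metis add.right_neutral add_left_cancel)
qed

lemma field_embedding_minus:
  assumes "field_embedding \<sigma>" shows "\<sigma> (- a) = - \<sigma> a"
proof -
  have "\<sigma> (a + - a) = \<sigma> a + \<sigma> (- a)"
    using assms unfolding field_embedding_def by blast
  then show ?thesis
    using field_embedding_0[OF assms] by (simp add: add_eq_0_iff)
qed

lemma field_embedding_diff:
  assumes "field_embedding \<sigma>" shows "\<sigma> (a - b) = \<sigma> a - \<sigma> b"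
proof -
  have "\<sigma> (a + - b) = \<sigma> a + \<sigma> (- b)"
    using assms unfolding field_embedding_def by blast
  then show ?thesis
    by (simp add: field_embedding_minus[OF assms])
qed

text \<open>A nonzero \<open>a\<close> is a unit, and its image times the image of its inverse is
  1.\<close>

lemma field_embedding_eq_0_iff:
  assumes "field_embedding \<sigma>" shows "\<sigma> a = 0 \<longleftrightarrow> a = 0"
proof
  assume "\<sigma> a = 0"
  show "a = 0"
  proof (rule ccontr)
    assume "a \<noteq> 0"
    then have "\<sigma> (a * inverse a) = 1"
      using assms by (simp add: field_embedding_def)
    moreover have "\<sigma> (a * inverse a) = \<sigma> a * \<sigma> (inverse a)"
      using assms unfolding field_embedding_def by blast
    ultimately show False
      using \<open>\<sigma> a = 0\<close> by simp
  qed
qed (simp add: field_embedding_0[OF assms])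

lemma field_embedding_divide:
  assumes "field_embedding \<sigma>" shows "\<sigma> (a / b) = \<sigma> a / \<sigma> b"
proof (cases "b = 0")
  case False
  then have "\<sigma> (a / b) * \<sigma> b = \<sigma> a"
    using assms unfolding field_embedding_def by (metis nonzero_eq_divide_eq)
  then show ?thesis
    using False by (simp add: field_embedding_eq_0_iff[OF assms] nonzero_eq_divide_eq)
qed (simp add: field_embedding_0[OF assms])

text \<open>Characteristic 0 passes from the complex numbers back to any field embedded in them.
  This supplies the characteristic assumption for Halley's method.\<close>

lemma field_embedding_complex_two_neq_0:
  fixes \<sigma> :: "'k::field \<Rightarrow> complex"
  assumes "field_embedding \<sigma>" shows "(2::'k) \<noteq> 0"
proof
  assume "(2::'k) = 0"
  moreover have "\<sigma> (1 + 1) = \<sigma> 1 + \<sigma> 1" and "\<sigma> 1 = 1"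
    using assms unfolding field_embedding_def by blast+
  ultimately show False
    using field_embedding_0[OF assms] by simp
qed

text \<open>This moves the sequence into the complex numbers, where moduli and limits are
  available.\<close>

lemma (in lucas_sequence) field_embedding_lucas:
  fixes \<sigma> :: "'k \<Rightarrow> 'l::field"
  assumes "field_embedding \<sigma>"
  shows "lucas_sequence (\<lambda>n. \<sigma> (u n)) (\<sigma> P) (\<sigma> Q)"
proof
  have mult: "\<sigma> (a * b) = \<sigma> a * \<sigma> b" for a b
    using assms unfolding field_embedding_def by blast
  show "\<sigma> (u (Suc (Suc n))) = \<sigma> P * \<sigma> (u (Suc n)) - \<sigma> Q * \<sigma> (u n)" for n
    unfolding u_rec field_embedding_diff[OF assms] mult ..
qed (use assms in \<open>simp_all add: field_embedding_0 field_embedding_def\<close>)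

section \<open>The recurrences, iterates and convergence for the sequence in the fraction
  field\<close>

theorem theorem3p2:
  fixes p q :: "'a::idom" and U :: "nat \<Rightarrow> 'a" and P Q :: "'a fract"
    and x :: "nat \<Rightarrow> 'a fract" and f :: "'a fract poly"
  assumes "U 0 = 0" and "U 1 = 1"
    and "\<And>n. n \<ge> 2 \<Longrightarrow> U n = p * U (n - 1) - q * U (n - 2)"
    and "\<And>n. n \<ge> 2 \<Longrightarrow> x n = to_fract (U n) / to_fract (U (n - 1))"
    and "P = to_fract p" and "Q = to_fract q"
    and "f = [:Q, - P, 1:]"
  shows
    "(\<forall>n\<ge>2. U (n - 1) \<noteq> 0 \<and> U (2*n - 2) \<noteq> 0 \<and> 2 * x n - P \<noteq> 0 \<longrightarrow>
        x (2*n - 1) = ((x n)\<^sup>2 - Q) / (2 * x n - P)) \<and>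
     (\<forall>n\<ge>2. U (n - 1) \<noteq> 0 \<and> U (3*n - 3) \<noteq> 0 \<and>
          3 * (x n)\<^sup>2 - 3 * P * x n + P\<^sup>2 - Q \<noteq> 0 \<longrightarrow>
        x (3*n - 2) = x n + ((x n)\<^sup>2 - P * x n + Q) * (P - 2 * x n)
                             / (3 * (x n)\<^sup>2 - 3 * P * x n + P\<^sup>2 - Q)) \<and>

     (\<forall>n\<ge>2. U (n - 1) \<noteq> 0 \<and> poly (pderiv f) (x n) \<noteq> 0 \<longrightarrow>
        ((x n)\<^sup>2 - Q) / (2 * x n - P) = newton_step f (x n)) \<and>
     (\<forall>n\<ge>2. U (n - 1) \<noteq> 0 \<and> halley_denom f (x n) \<noteq> 0 \<longrightarrow>
        x n + ((x n)\<^sup>2 - P * x n + Q) * (P - 2 * x n)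
               / (3 * (x n)\<^sup>2 - 3 * P * x n + P\<^sup>2 - Q) = halley_step f (x n)) \<and>

     (\<forall>n\<ge>2::nat. strict_mono (\<lambda>k::nat. 2^k * (n - 1) + 1 :: nat) \<and> strict_mono (\<lambda>k::nat. 3^k * (n - 1) + 1 :: nat)) \<and>
     (\<forall>n\<ge>2. \<forall>k y. y 0 = x n \<and>
          (\<forall>j<k. 2 * y j - P \<noteq> 0 \<and> y (Suc j) = ((y j)\<^sup>2 - Q) / (2 * y j - P)) \<and>
          (\<forall>j\<le>k. U (2^j * (n - 1)) \<noteq> 0) \<longrightarrow>
        y k = x (2^k * (n - 1) + 1)) \<and>
     (\<forall>n\<ge>2. \<forall>k y. y 0 = x n \<and>
          (\<forall>j<k. 3 * (y j)\<^sup>2 - 3 * P * y j + P\<^sup>2 - Q \<noteq> 0 \<and>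
             y (Suc j) = y j + ((y j)\<^sup>2 - P * y j + Q) * (P - 2 * y j)
                                / (3 * (y j)\<^sup>2 - 3 * P * y j + P\<^sup>2 - Q)) \<and>
          (\<forall>j\<le>k. U (3^j * (n - 1)) \<noteq> 0) \<longrightarrow>
        y k = x (3^k * (n - 1) + 1)) \<and>

     (\<forall>n\<ge>2. \<forall>k. (\<forall>j<k. poly (pderiv f) ((newton_step f ^^ j) (x n)) \<noteq> 0) \<and>
          (\<forall>j\<le>k. U (2^j * (n - 1)) \<noteq> 0) \<longrightarrow>
        (newton_step f ^^ k) (x n) = x (2^k * (n - 1) + 1)) \<and>
     (\<forall>n\<ge>2. \<forall>k. (\<forall>j<k. halley_denom f ((halley_step f ^^ j) (x n)) \<noteq> 0) \<and>
          (\<forall>j\<le>k. U (3^j * (n - 1)) \<noteq> 0) \<longrightarrow>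
        (halley_step f ^^ k) (x n) = x (3^k * (n - 1) + 1)) \<and>

     (\<forall>(\<sigma> :: 'a fract \<Rightarrow> complex) \<alpha> \<beta>.
        field_embedding \<sigma> \<and> map_poly \<sigma> f = [:- \<alpha>, 1:] * [:- \<beta>, 1:] \<and> cmod \<beta> < cmod \<alpha> \<longrightarrow>
        (\<forall>m\<ge>1. U m \<noteq> 0) \<and>
        (\<forall>n\<ge>2.
           (\<forall>k. poly (pderiv f) ((newton_step f ^^ k) (x n)) \<noteq> 0) \<and>
           (\<forall>k. halley_denom f ((halley_step f ^^ k) (x n)) \<noteq> 0) \<and>
           (\<lambda>k. \<sigma> ((newton_step f ^^ k) (x n))) \<longlonglongrightarrow> \<alpha> \<and>
           (\<lambda>k. \<sigma> ((halley_step f ^^ k) (x n))) \<longlonglongrightarrow> \<alpha>))"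
proof -
  define u where "u = (\<lambda>n. to_fract (U n))"
  have u_0_iff: "u n = 0 \<longleftrightarrow> U n = 0" for n
    by (simp add: u_def)
  interpret lucas_sequence u P Q
  proof
    show "u (Suc (Suc n)) = P * u (Suc n) - Q * u n" for n
      using assms(3)[of "Suc (Suc n)"] by (simp add: u_def assms(5,6))
  qed (use assms(1,2) in \<open>simp_all add: u_def\<close>)
  have x_eq: "x n = ratio (n - 1)" if "n \<ge> 2" for n
  proof -
    have "x n = u n / u (n - 1)"
      by (simp add: u_def assms(4) that)
    then show ?thesis
      using that by (simp add: ratio_def)
  qed
  have x_pow: "x (b ^ k * (n - 1) + 1) = ratio (b ^ k * (n - 1))" if "n \<ge> 2" "b > 0" for b k n :: nat
    using x_eq[of "b ^ k * (n - 1) + 1"] that by simp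
  \<comment> \<open>The claims build on each other: no positive-index term vanishes, hence no
    iterate degenerates, hence the iterates are ratios at the indices \<open>2 ^ k * m\<close> and
    \<open>3 ^ k * m\<close>, and these are subsequences of a sequence whose image tends to
    \<alpha>.\<close>
  have conv: "(\<forall>m\<ge>1. U m \<noteq> 0) \<and>
        (\<forall>n\<ge>2.
           (\<forall>k. poly (pderiv f) ((newton_step f ^^ k) (x n)) \<noteq> 0) \<and>
           (\<forall>k. halley_denom f ((halley_step f ^^ k) (x n)) \<noteq> 0) \<and>
           (\<lambda>k. \<sigma> ((newton_step f ^^ k) (x n))) \<longlonglongrightarrow> \<alpha> \<and>
           (\<lambda>k. \<sigma> ((halley_step f ^^ k) (x n))) \<longlonglongrightarrow> \<alpha>)"
    if \<sigma>: "field_embedding \<sigma>" and roots: "map_poly \<sigma> f = [:- \<alpha>, 1:] * [:- \<beta>, 1:]"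
      and less: "cmod \<beta> < cmod \<alpha>" for \<sigma> :: "'a fract \<Rightarrow> complex" and \<alpha> \<beta>
  proof -
    \<comment> \<open>Comparing coefficients with the factorisation gives the sum and the product of
      the roots.\<close>
    have "\<sigma> Q = coeff (map_poly \<sigma> f) 0" "\<sigma> P = - coeff (map_poly \<sigma> f) 1"
      by (simp_all add: coeff_map_poly field_embedding_0[OF \<sigma>] field_embedding_minus[OF \<sigma>] assms(7))
    then have "\<sigma> P = \<alpha> + \<beta>" "\<sigma> Q = \<alpha> * \<beta>"
      by (simp_all add: roots)
    then have lucas: "lucas_sequence (\<lambda>n. \<sigma> (u n)) (\<alpha> + \<beta>) (\<alpha> * \<beta>)"
      using field_embedding_lucas[OF \<sigma>] by simp
    \<comment> \<open>Nonvanishing is proved for the complex image and pulled back, since an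
      embedding sends 0 to 0.\<close>
    have u_nz: "u m \<noteq> 0" if "m \<ge> 1" for m
      using lucas_complex_nonzero[OF lucas less that] field_embedding_0[OF \<sigma>] by auto
    have lim: "(\<lambda>m. \<sigma> (ratio m)) \<longlonglongrightarrow> \<alpha>"
      using lucas_complex_ratio_tendsto[OF lucas less]
      by (simp add: ratio_def field_embedding_divide[OF \<sigma>])
    have lim_sub: "(\<lambda>k. \<sigma> (ratio (b ^ k * m))) \<longlonglongrightarrow> \<alpha>" if "b > 1" "m \<ge> 1" for b m :: nat
    proof -
      \<comment> \<open>A base above 1 and a positive \<open>m\<close> make the indices a genuine
        subsequence.\<close>
      have "strict_mono (\<lambda>k. b ^ k * m)"
        using that by (auto simp: strict_mono_Suc_iff)
      from LIMSEQ_subseq_LIMSEQ[OF lim this] show ?thesis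
        by (simp add: o_def)
    qed
    have newton_nz: "poly (pderiv f) ((newton_step f ^^ k) (ratio m)) \<noteq> 0" if "m \<ge> 1" for k m
      unfolding assms(7) using u_nz that by (rule newton_iterate_nondegenerate)
    have halley_nz: "halley_denom f ((halley_step f ^^ k) (ratio m)) \<noteq> 0" if "m \<ge> 1" for k m
      unfolding assms(7) using u_nz that field_embedding_complex_two_neq_0[OF \<sigma>]
      by (rule halley_iterate_nondegenerate)
    have "(newton_step f ^^ k) (ratio m) = ratio (2 ^ k * m)" if "m \<ge> 1" for k m
      unfolding assms(7)
      using newton_nz[OF that, unfolded assms(7)] u_nz that by (intro newton_step_iterate) auto
    moreover have "(halley_step f ^^ k) (ratio m) = ratio (3 ^ k * m)" if "m \<ge> 1" for k m
      unfolding assms(7)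
      using halley_nz[OF that, unfolded assms(7)] u_nz that by (intro halley_step_iterate) auto
    ultimately show ?thesis
      using newton_nz halley_nz lim_sub u_nz by (auto simp: x_eq u_0_iff)
  qed
  show ?thesis
  proof (intro conjI)
    show "\<forall>n\<ge>2. U (n - 1) \<noteq> 0 \<and> U (2*n - 2) \<noteq> 0 \<and> 2 * x n - P \<noteq> 0 \<longrightarrow>
        x (2*n - 1) = ((x n)\<^sup>2 - Q) / (2 * x n - P)"
    proof (intro allI impI)
      fix n :: nat
      assume "n \<ge> 2" and "U (n - 1) \<noteq> 0 \<and> U (2*n - 2) \<noteq> 0 \<and> 2 * x n - P \<noteq> 0"
      \<comment> \<open>Subtraction is truncated, so the bound on the new index and its shift by one
        to \<open>2 * (n - 1)\<close> are recorded before passing to \<open>ratio\<close>.\<close>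
      then have "u (n - 1) \<noteq> 0" and "2 * n - 1 \<ge> 2" and "2 * n - 1 - 1 = 2 * (n - 1)"
        by (auto simp: u_0_iff)
      then have u_nz: "u (n - 1) \<noteq> 0" and x_mult: "x (2 * n - 1) = ratio (2 * (n - 1))"
        using x_eq[of "2 * n - 1"] by simp_all
      show "x (2*n - 1) = ((x n)\<^sup>2 - Q) / (2 * x n - P)"
        unfolding x_mult x_eq[OF \<open>n \<ge> 2\<close>] using u_nz by (rule ratio_double)
    qed
    show "\<forall>n\<ge>2. U (n - 1) \<noteq> 0 \<and> U (3*n - 3) \<noteq> 0 \<and>
          3 * (x n)\<^sup>2 - 3 * P * x n + P\<^sup>2 - Q \<noteq> 0 \<longrightarrow>
        x (3*n - 2) = x n + ((x n)\<^sup>2 - P * x n + Q) * (P - 2 * x n)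
                             / (3 * (x n)\<^sup>2 - 3 * P * x n + P\<^sup>2 - Q)"
    proof (intro allI impI)
      fix n :: nat
      assume "n \<ge> 2" and *: "U (n - 1) \<noteq> 0 \<and> U (3*n - 3) \<noteq> 0 \<and>
          3 * (x n)\<^sup>2 - 3 * P * x n + P\<^sup>2 - Q \<noteq> 0"
      then have "u (n - 1) \<noteq> 0" and "3 * n - 2 \<ge> 2" and "3 * n - 2 - 1 = 3 * (n - 1)"
        by (auto simp: u_0_iff)
      then have u_nz: "u (n - 1) \<noteq> 0" and x_mult: "x (3 * n - 2) = ratio (3 * (n - 1))"
        using x_eq[of "3 * n - 2"] by simp_all
      show "x (3*n - 2) = x n + ((x n)\<^sup>2 - P * x n + Q) * (P - 2 * x n)
                             / (3 * (x n)\<^sup>2 - 3 * P * x n + P\<^sup>2 - Q)"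
        unfolding x_mult x_eq[OF \<open>n \<ge> 2\<close>]
        using u_nz *[unfolded x_eq[OF \<open>n \<ge> 2\<close>]] by (blast intro: ratio_triple)
    qed
    show "\<forall>n\<ge>2. U (n - 1) \<noteq> 0 \<and> poly (pderiv f) (x n) \<noteq> 0 \<longrightarrow>
        ((x n)\<^sup>2 - Q) / (2 * x n - P) = newton_step f (x n)"
      by (simp add: assms(7) poly_pderiv_quadratic newton_step_quadratic)
    show "\<forall>n\<ge>2. U (n - 1) \<noteq> 0 \<and> halley_denom f (x n) \<noteq> 0 \<longrightarrow>
        x n + ((x n)\<^sup>2 - P * x n + Q) * (P - 2 * x n)
               / (3 * (x n)\<^sup>2 - 3 * P * x n + P\<^sup>2 - Q) = halley_step f (x n)"
      by (simp add: assms(7) halley_step_quadratic)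
    show "\<forall>n\<ge>2::nat. strict_mono (\<lambda>k::nat. 2^k * (n - 1) + 1 :: nat) \<and>
        strict_mono (\<lambda>k::nat. 3^k * (n - 1) + 1 :: nat)"
      by (auto simp: strict_mono_Suc_iff)
    show "\<forall>n\<ge>2. \<forall>k y. y 0 = x n \<and>
          (\<forall>j<k. 2 * y j - P \<noteq> 0 \<and> y (Suc j) = ((y j)\<^sup>2 - Q) / (2 * y j - P)) \<and>
          (\<forall>j\<le>k. U (2^j * (n - 1)) \<noteq> 0) \<longrightarrow>
        y k = x (2^k * (n - 1) + 1)"
    proof (intro allI impI)
      fix n k :: nat and y :: "nat \<Rightarrow> _"
      assume "n \<ge> 2" and *: "y 0 = x n \<and>
          (\<forall>j<k. 2 * y j - P \<noteq> 0 \<and> y (Suc j) = ((y j)\<^sup>2 - Q) / (2 * y j - P)) \<and>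
          (\<forall>j\<le>k. U (2^j * (n - 1)) \<noteq> 0)"
      show "y k = x (2^k * (n - 1) + 1)"
        \<comment> \<open>Adding 1 to the index in \<open>x\<close> undoes the shift, so the target
          is the ratio at \<open>2 ^ k * (n - 1)\<close>.\<close>
        unfolding x_pow[OF \<open>n \<ge> 2\<close> zero_less_numeral]
        by (rule newton_iterate_eq_ratio) (use * \<open>n \<ge> 2\<close> in \<open>auto simp: x_eq u_0_iff\<close>)
    qed
    show "\<forall>n\<ge>2. \<forall>k y. y 0 = x n \<and>
          (\<forall>j<k. 3 * (y j)\<^sup>2 - 3 * P * y j + P\<^sup>2 - Q \<noteq> 0 \<and>
             y (Suc j) = y j + ((y j)\<^sup>2 - P * y j + Q) * (P - 2 * y j)
                                / (3 * (y j)\<^sup>2 - 3 * P * y j + P\<^sup>2 - Q)) \<and>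
          (\<forall>j\<le>k. U (3^j * (n - 1)) \<noteq> 0) \<longrightarrow>
        y k = x (3^k * (n - 1) + 1)"
    proof (intro allI impI)
      fix n k :: nat and y :: "nat \<Rightarrow> _"
      assume "n \<ge> 2" and *: "y 0 = x n \<and>
          (\<forall>j<k. 3 * (y j)\<^sup>2 - 3 * P * y j + P\<^sup>2 - Q \<noteq> 0 \<and>
             y (Suc j) = y j + ((y j)\<^sup>2 - P * y j + Q) * (P - 2 * y j)
                                / (3 * (y j)\<^sup>2 - 3 * P * y j + P\<^sup>2 - Q)) \<and>
          (\<forall>j\<le>k. U (3^j * (n - 1)) \<noteq> 0)"
      show "y k = x (3^k * (n - 1) + 1)"
        unfolding x_pow[OF \<open>n \<ge> 2\<close> zero_less_numeral]
        by (rule halley_iterate_eq_ratio) (use * \<open>n \<ge> 2\<close> in \<open>auto simp: x_eq u_0_iff\<close>)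
    qed
    show "\<forall>n\<ge>2. \<forall>k. (\<forall>j<k. poly (pderiv f) ((newton_step f ^^ j) (x n)) \<noteq> 0) \<and>
          (\<forall>j\<le>k. U (2^j * (n - 1)) \<noteq> 0) \<longrightarrow>
        (newton_step f ^^ k) (x n) = x (2^k * (n - 1) + 1)"
    proof (intro allI impI)
      fix n k :: nat
      assume "n \<ge> 2" and *: "(\<forall>j<k. poly (pderiv f) ((newton_step f ^^ j) (x n)) \<noteq> 0) \<and>
          (\<forall>j\<le>k. U (2^j * (n - 1)) \<noteq> 0)"
      show "(newton_step f ^^ k) (x n) = x (2^k * (n - 1) + 1)"
        unfolding x_pow[OF \<open>n \<ge> 2\<close> zero_less_numeral] x_eq[OF \<open>n \<ge> 2\<close>] assms(7)
        by (rule newton_step_iterate) (use * \<open>n \<ge> 2\<close> in \<open>auto simp: x_eq u_0_iff assms(7)\<close>)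
    qed
    show "\<forall>n\<ge>2. \<forall>k. (\<forall>j<k. halley_denom f ((halley_step f ^^ j) (x n)) \<noteq> 0) \<and>
          (\<forall>j\<le>k. U (3^j * (n - 1)) \<noteq> 0) \<longrightarrow>
        (halley_step f ^^ k) (x n) = x (3^k * (n - 1) + 1)"
    proof (intro allI impI)
      fix n k :: nat
      assume "n \<ge> 2" and *: "(\<forall>j<k. halley_denom f ((halley_step f ^^ j) (x n)) \<noteq> 0) \<and>
          (\<forall>j\<le>k. U (3^j * (n - 1)) \<noteq> 0)"
      show "(halley_step f ^^ k) (x n) = x (3^k * (n - 1) + 1)"
        unfolding x_pow[OF \<open>n \<ge> 2\<close> zero_less_numeral] x_eq[OF \<open>n \<ge> 2\<close>] assms(7)
        by (rule halley_step_iterate) (use * \<open>n \<ge> 2\<close> in \<open>auto simp: x_eq u_0_iff assms(7)\<close>)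
    qed
  qed (use conv in blast)
qed

end
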